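(* Let $s>0$ be irrational, let $G=(\mathbb Z/4)*(\mathbb Z/4)$, let $\mathbb T^4=\mathbb C^2/(\mathbb Z[i])^2$, and let $\Psi:\mathbb C\to\mathbb T^4$ be given by $\Psi(w)=(w,w/s) \bmod (\mathbb Z[i])^2$. There is a piecewise affine action $\widehat G_s$ of $G$ on $\mathbb T^4$ (denote by $\widehat g_s$ the piecewise affine map by which $g\in G$ acts) having the following properties. (1) For any $z\in\mathbb C$ there is some translation $\widehat\tau$ of $\mathbb T^4$ such that $\widehat\tau\circ\Psi$ conjugates the action $g\mapsto g_{s,z}$ of $G$ on $\mathbb C$ to the action of $\widehat G_s$ on $\widehat\tau\circ\Psi(\mathbb C)$. (2) For each $g\in G$, the element $\widehat g_s$ acts on $\mathbb T^4$ in such a way that its linear part $L_{g,s}$ is independent of the point where it is evaluated. (3) When $g\in G^0$ is stationary, $L_{g,s}$ is the identity, so that $\widehat g_s$ is a polytope exchange transformation. (4) When $g\in G^0$ is a drifter, $L_{g,s}$ is a nontrivial complex linear parabolic, and the fixed space of $L_{g,s}$ is parallel to $\Psi(\mathbb C)$.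
   Context: For $s>0$ and $z\in\mathbb C$, let $G_{s,z}$ be the infinite grid of squares of side length $s$ in $\mathbb C$, with sides parallel to the coordinate axes, having $z$ as a vertex. Let $R_{s,z}$ be the map, defined on the interiors of the squares of $G_{s,z}$, which rotates each square about its own center clockwise by $\pi/2$. Let $A_1,A_2$ be the standard generators of $G=(\mathbb Z/4)*(\mathbb Z/4)$, and let $G^0\subset G$ be the index $4$ subgroup of words whose total exponent is divisible by $4$. For $g\in G$, $g_{s,z}$ is the partially defined map of $\mathbb C$ obtained from the word $g$ by replacing $A_1$ with $R_{1,0}$ and $A_2$ with $R_{s,z}$ and composing. Let $H:G\to \mathrm{Isom}(\mathbb C)$ be the homomorphism for which $H(A_1)$ is the counterclockwise rotation by $\pi/2$ about $0$ and $H(A_2)$ is the counterclockwise rotation by $\pi/2$ about $1$. A word $g\in G^0$ is stationary if $H(g)$ is the identity and a drifter otherwise. A piecewise affine map of $\mathbb T^4$ is a map defined and affine on the interior of each polytope of a finite partition of $\mathbb T^4$ into polytopes; it need not be defined on the boundaries. All equalities of maps (the action relations and the conjugacy, i.e. $\widehat\tau\circ\Psi\circ g_{s,z}=\widehat g_s\circ\widehat\tau\circ\Psi$) are understood wherever all maps involved are defined. A polytope exchange transformation is a piecewise translation that is injective with dense (full measure) image. A nontrivial complex linear parabolic is a $\mathbb C$-linear unipotent map (all eigenvalues equal to $1$) different from the identity; "parallel to $\Psi(\mathbb C)$" means equal to the complex line spanned by $(1,1/s)$. *)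

theory Defs
  imports "HOL-Analysis.Analysis" "HOL-Algebra.Group"
begin

section \<open>The group \<open>(\<int>/4) * (\<int>/4)\<close>\<close>

datatype gen = A1 | A2

text \<open>
  The inverse of a generator \<open>a\<close> is \<open>a\<^sup>3\<close>, so each element of the free product has exactly
  one expression as a positive word in \<open>A1\<close>, \<open>A2\<close> without four consecutive equal letters.
  These words are taken as the elements of the group.  The word \<open>[a\<^sub>1, \<dots>, a\<^sub>n]\<close> stands for the
  product \<open>a\<^sub>1 \<cdots> a\<^sub>n\<close>, and actions are left actions (\<open>a\<^sub>n\<close> is applied first).
\<close>

definition reduced_word :: "gen list \<Rightarrow> bool" where
  "reduced_word w \<longleftrightarrow> (\<nexists>u a v. w = u @ replicate 4 a @ v)"

definition push :: "gen \<Rightarrow> gen list \<Rightarrow> gen list" where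
  "push a w = (if take 3 w = replicate 3 a then drop 3 w else a # w)"

definition Z4_free_Z4 :: "gen list monoid" where
  "Z4_free_Z4 = \<lparr>carrier = {w. reduced_word w}, monoid.mult = (\<lambda>u v. foldr push u v), one = []\<rparr>"

abbreviation G4 :: "gen list monoid" where "G4 \<equiv> Z4_free_Z4"

lemma reduced_word_Nil [simp]: "reduced_word []"
  by (simp add: reduced_word_def)

lemma reduced_word_short: "length w < 4 \<Longrightarrow> reduced_word w"
  by (auto simp: reduced_word_def)

lemma reduced_word_ConsD: "reduced_word (a # w) \<Longrightarrow> reduced_word w"
  unfolding reduced_word_def by (metis append_Cons)

lemma reduced_word_appendD: "reduced_word (u @ w) \<Longrightarrow> reduced_word w"
  by (induction u) (auto dest: reduced_word_ConsD)

lemma reduced_word_push: "reduced_word w \<Longrightarrow> reduced_word (push a w)"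
proof (cases "take 3 w = replicate 3 a")
  case True
  assume "reduced_word w"
  moreover have "w = take 3 w @ drop 3 w" by simp
  ultimately have "reduced_word (drop 3 w)" using reduced_word_appendD by metis
  with True show ?thesis by (simp add: push_def)
next
  case False
  assume w: "reduced_word w"
  have "reduced_word (a # w)"
    unfolding reduced_word_def
  proof clarify
    fix u b v assume eq: "a # w = u @ replicate 4 b @ v"
    show False
    proof (cases u)
      case Nil
      then show False using eq False by (auto simp: numeral_eq_Suc)
    next
      case (Cons c u')
      then show False using eq w by (auto simp: reduced_word_def)
    qed
  qed
  with False show ?thesis by (simp add: push_def)
qed

lemma take_3_replicate: "take 3 w = replicate 3 a \<Longrightarrow> w = a # a # a # drop 3 w"
  by (metis append_Cons append_Nil append_take_drop_id numeral_3_eq_3 replicate_Suc replicate_0)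

lemma push_reduced_Cons: "reduced_word (a # w) \<Longrightarrow> push a w = a # w"
proof -
  assume r: "reduced_word (a # w)"
  have "take 3 w \<noteq> replicate 3 a"
  proof
    assume "take 3 w = replicate 3 a"
    then obtain t where "w = a # a # a # t" by (metis take_3_replicate)
    then have "a # w = [] @ replicate 4 a @ t" by (simp add: numeral_eq_Suc)
    with r show False unfolding reduced_word_def by blast
  qed
  then show ?thesis by (simp add: push_def)
qed

lemma push_4: "reduced_word w \<Longrightarrow> push a (push a (push a (push a w))) = w"
proof -
  assume r: "reduced_word w"
  have n: "\<not> (\<exists>v. w = a # a # a # a # v)"
  proof
    assume "\<exists>v. w = a # a # a # a # v"
    then obtain v where "w = [] @ replicate 4 a @ v" by (auto simp: numeral_eq_Suc)
    with r show False unfolding reduced_word_def by blast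
  qed
  obtain k v where w: "w = replicate k a @ v" and v: "v = [] \<or> hd v \<noteq> a"
    using that[of "length (takeWhile ((=) a) w)" "dropWhile ((=) a) w"]
    by (metis (full_types) hd_dropWhile replicate_length_same set_takeWhileD takeWhile_dropWhile_id)
  have "k < 4"
  proof (rule ccontr)
    assume "\<not> k < 4"
    then have "w = replicate 4 a @ (replicate (k - 4) a @ v)"
      using w by (metis append.assoc le_add_diff_inverse not_less replicate_add)
    with n show False by (auto simp: numeral_eq_Suc)
  qed
  then consider "k = 0" | "k = 1" | "k = 2" | "k = 3" by linarith
  then show ?thesis
    using v unfolding w by cases (cases v; auto simp: push_def numeral_eq_Suc)+
qed

lemma reduced_word_foldr: "reduced_word v \<Longrightarrow> reduced_word (foldr push u v)"
  by (induction u) (auto intro: reduced_word_push)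

lemma foldr_push_Nil: "reduced_word w \<Longrightarrow> foldr push w [] = w"
  proof (induction w)
  case (Cons a w)
  then show ?case using reduced_word_ConsD[of a w] push_reduced_Cons[of a w] by simp
qed simp

lemma foldr_push_push:
  assumes "reduced_word u" "reduced_word v"
  shows "foldr push (push a u) v = push a (foldr push u v)"
proof (cases "take 3 u = replicate 3 a")
  case True
  then obtain t where u: "u = a # a # a # t" by (metis take_3_replicate)
  then have "foldr push u v = push a (push a (push a (foldr push t v)))" by simp
  with True assms show ?thesis by (simp add: push_def[of a "a # a # a # t"] u push_4 reduced_word_foldr numeral_eq_Suc)
next
  case False
  then show ?thesis by (simp add: push_def[of a u])
qed

lemma foldr_push_assoc:
  assumes "reduced_word v" "reduced_word w"
  shows "foldr push (foldr push u v) w = foldr push u (foldr push v w)"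
  using assms by (induction u) (auto simp: foldr_push_push reduced_word_foldr)

theorem group_G4: "group G4"
proof (rule groupI)
  fix x assume "x \<in> carrier G4"
  then have "reduced_word x" by (simp add: Z4_free_Z4_def)
  then have "\<exists>y. reduced_word y \<and> foldr push y x = []"
  proof (induction x)
    case (Cons a x)
    then obtain y where y: "reduced_word y" "foldr push y x = []"
      using reduced_word_ConsD by blast
    have rx: "reduced_word x" using Cons.prems reduced_word_ConsD by blast
    let ?i = "[a, a, a]"
    have ri: "reduced_word ?i" by (simp add: reduced_word_short)
    have "foldr push (foldr push y ?i) (a # x) = foldr push y (foldr push ?i (a # x))"
      using ri Cons.prems by (rule foldr_push_assoc)
    also have "foldr push ?i (a # x) = x"
      using push_4[OF rx, of a] push_reduced_Cons[OF Cons.prems] by simp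
    finally show ?case using y reduced_word_foldr[OF ri, of y] by auto
  qed (auto intro: exI[of _ "[]"])
  then show "\<exists>y\<in>carrier G4. y \<otimes>\<^bsub>G4\<^esub> x = \<one>\<^bsub>G4\<^esub>"
    by (auto simp: Z4_free_Z4_def)
qed (auto simp: Z4_free_Z4_def reduced_word_foldr foldr_push_assoc)

text \<open>The universal property of the free product of two cyclic groups of order four.\<close>

theorem G4_universal:
  assumes "group K" and x: "\<And>a. x a \<in> carrier K" "\<And>a. x a [^]\<^bsub>K\<^esub> (4::nat) = \<one>\<^bsub>K\<^esub>"
  defines "\<phi> \<equiv> \<lambda>w. foldr (\<lambda>a r. x a \<otimes>\<^bsub>K\<^esub> r) w \<one>\<^bsub>K\<^esub>"
  shows "\<phi> \<in> hom G4 K" and "\<phi> [a] = x a"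
    and "\<And>\<psi> w. \<lbrakk>\<psi> \<in> hom G4 K; \<And>a. \<psi> [a] = x a; w \<in> carrier G4\<rbrakk> \<Longrightarrow> \<psi> w = \<phi> w"
proof -
  interpret K: group K by fact
  have cl: "\<phi> w \<in> carrier K" for w
    by (induction w) (auto simp: \<phi>_def x)
  have x4: "x a \<otimes>\<^bsub>K\<^esub> (x a \<otimes>\<^bsub>K\<^esub> (x a \<otimes>\<^bsub>K\<^esub> (x a \<otimes>\<^bsub>K\<^esub> r))) = r" if "r \<in> carrier K" for a r
  proof -
    have "x a \<otimes>\<^bsub>K\<^esub> (x a \<otimes>\<^bsub>K\<^esub> (x a \<otimes>\<^bsub>K\<^esub> (x a \<otimes>\<^bsub>K\<^esub> r))) = x a [^]\<^bsub>K\<^esub> (4::nat) \<otimes>\<^bsub>K\<^esub> r"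
      using that x(1)[of a] by (simp add: numeral_eq_Suc K.m_assoc)
    with x(2) that show ?thesis by simp
  qed
  have push: "\<phi> (push a w) = x a \<otimes>\<^bsub>K\<^esub> \<phi> w" for a w
  proof (cases "take 3 w = replicate 3 a")
    case True
    then obtain t where w: "w = a # a # a # t" by (metis take_3_replicate)
    then have "\<phi> w = x a \<otimes>\<^bsub>K\<^esub> (x a \<otimes>\<^bsub>K\<^esub> (x a \<otimes>\<^bsub>K\<^esub> \<phi> t))"
      by (simp add: \<phi>_def)
    with True show ?thesis by (simp add: push_def w x4 cl)
  qed (simp add: push_def \<phi>_def)
  have "\<phi> (foldr push u v) = \<phi> u \<otimes>\<^bsub>K\<^esub> \<phi> v" for u v
  proof (induction u)
    case Nil
    have "\<phi> [] = \<one>\<^bsub>K\<^esub>" by (simp add: \<phi>_def)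
    then show ?case using cl[of v] by simp
  next
    case (Cons b u)
    have "\<phi> (b # u) = x b \<otimes>\<^bsub>K\<^esub> \<phi> u" by (simp add: \<phi>_def)
    then show ?case using Cons cl x(1) by (simp add: push K.m_assoc)
  qed
  then show "\<phi> \<in> hom G4 K" by (auto simp: hom_def Z4_free_Z4_def cl)
  show "\<phi> [a] = x a" by (simp add: \<phi>_def x)
  fix \<psi> w assume \<psi>: "\<psi> \<in> hom G4 K" "\<And>a. \<psi> [a] = x a" and "w \<in> carrier G4"
  from \<open>w \<in> carrier G4\<close> have "reduced_word w" by (simp add: Z4_free_Z4_def)
  then show "\<psi> w = \<phi> w"
  proof (induction w)
    case Nil
    have "\<psi> \<one>\<^bsub>G4\<^esub> = \<one>\<^bsub>K\<^esub>"
      using \<psi>(1) group_G4 K.is_group by (rule hom_one)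
    then show ?case by (simp add: \<phi>_def Z4_free_Z4_def)
  next
    case (Cons b w)
    have rw: "reduced_word w" and rb: "reduced_word [b]"
      using Cons.prems reduced_word_ConsD by (blast, simp add: reduced_word_short)
    have "\<psi> ([b] \<otimes>\<^bsub>G4\<^esub> w) = \<psi> [b] \<otimes>\<^bsub>K\<^esub> \<psi> w"
      using \<psi>(1) rw rb by (intro hom_mult) (auto simp: Z4_free_Z4_def)
    then show ?case
      using Cons.IH rw \<psi>(2) push_reduced_Cons[OF Cons.prems] by (simp add: Z4_free_Z4_def \<phi>_def)
  qed
qed

text \<open>Words are positive, so the total exponent is the length.\<close>

definition G0 :: "gen list set" where
  "G0 = {g \<in> carrier G4. 4 dvd length g}"


section \<open>Square turning maps and the homomorphism to \<open>Isom(\<complex>)\<close>\<close>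

definition rotation :: "real \<Rightarrow> complex \<Rightarrow> complex \<Rightarrow> complex" where
  "rotation \<theta> c w = c + cis \<theta> * (w - c)"

definition grid_square :: "real \<Rightarrow> complex \<Rightarrow> int \<Rightarrow> int \<Rightarrow> complex set" where
  "grid_square s z m n = cbox (z + of_real s * Complex (of_int m) (of_int n))
                              (z + of_real s * Complex (of_int m + 1) (of_int n + 1))"

definition square_center :: "real \<Rightarrow> complex \<Rightarrow> int \<Rightarrow> int \<Rightarrow> complex" where
  "square_center s z m n = z + of_real s * Complex (of_int m + 1/2) (of_int n + 1/2)"

definition square_turn :: "real \<Rightarrow> complex \<Rightarrow> complex \<rightharpoonup> complex" where
  "square_turn s z w =
     (if \<exists>m n. w \<in> interior (grid_square s z m n)
      then Some (THE w'. \<exists>m n. w \<in> interior (grid_square s z m n) \<and>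
                               w' = rotation (- pi / 2) (square_center s z m n) w)
      else None)"

text \<open>The value in \<^const>\<open>square_turn\<close> is unambiguous.\<close>

lemma interior_grid_square:
  "interior (grid_square s z m n) =
     {w. Re z + s * m < Re w \<and> Re w < Re z + s * (m + 1) \<and>
         Im z + s * n < Im w \<and> Im w < Im z + s * (n + 1)}"
  by (auto simp: grid_square_def interior_cbox in_box_complex_iff)

lemma square_turn_eq:
  assumes "s > 0" and w: "w \<in> interior (grid_square s z m n)"
  shows "square_turn s z w = Some (rotation (- pi / 2) (square_center s z m n) w)"
proof -
  have uniq: "k = l" if "s * of_int k < t" "t < s * (of_int k + 1)"
    "s * of_int l < t" "t < s * (of_int l + 1)" for k l :: int and t :: real
  proof -
    have "of_int k < t / s" "t / s < of_int k + 1" "of_int l < t / s" "t / s < of_int l + 1"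
      using that \<open>s > 0\<close> by (simp_all add: field_simps)
    then show ?thesis by linarith
  qed
  have "m' = m \<and> n' = n" if "w \<in> interior (grid_square s z m' n')" for m' n'
    using that w uniq[of m' "Re w - Re z" m] uniq[of n' "Im w - Im z" n]
    by (simp add: interior_grid_square)
  then have *: "(THE w'. \<exists>m n. w \<in> interior (grid_square s z m n) \<and>
       w' = rotation (- pi / 2) (square_center s z m n) w)
     = rotation (- pi / 2) (square_center s z m n) w"
    using w by (intro the_equality) blast+
  from w have "\<exists>m n. w \<in> interior (grid_square s z m n)" by blast
  then show ?thesis unfolding square_turn_def * by simp
qed

primrec turn_gen :: "real \<Rightarrow> complex \<Rightarrow> gen \<Rightarrow> complex \<rightharpoonup> complex" where
  "turn_gen s z A1 = square_turn 1 0"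
| "turn_gen s z A2 = square_turn s z"

definition square_action :: "real \<Rightarrow> complex \<Rightarrow> gen list \<Rightarrow> complex \<rightharpoonup> complex" where
  "square_action s z g = foldr (\<lambda>a f. turn_gen s z a \<circ>\<^sub>m f) g Some"

primrec rot_gen :: "gen \<Rightarrow> complex \<Rightarrow> complex" where
  "rot_gen A1 = rotation (pi / 2) 0"
| "rot_gen A2 = rotation (pi / 2) 1"

definition isom_hom :: "gen list \<Rightarrow> complex \<Rightarrow> complex" where
  "isom_hom g = foldr (\<lambda>a f. rot_gen a \<circ> f) g id"

lemma isom_hom_mult: "isom_hom (u \<otimes>\<^bsub>G4\<^esub> v) = isom_hom u \<circ> isom_hom v"
proof -
  have r4: "rot_gen a \<circ> (rot_gen a \<circ> (rot_gen a \<circ> (rot_gen a \<circ> f))) = f" for a f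
    by (cases a) (auto simp: fun_eq_iff rotation_def algebra_simps)
  have push: "isom_hom (push a w) = rot_gen a \<circ> isom_hom w" for a w
  proof (cases "take 3 w = replicate 3 a")
    case True
    then obtain t where w: "w = a # a # a # t" by (metis take_3_replicate)
    then have "isom_hom w = rot_gen a \<circ> (rot_gen a \<circ> (rot_gen a \<circ> isom_hom t))"
      by (simp add: isom_hom_def)
    with True show ?thesis by (simp add: push_def w r4)
  qed (simp add: push_def isom_hom_def)
  show ?thesis
  proof (induction u)
    case (Cons a u)
    then show ?case by (auto simp: Z4_free_Z4_def push) (simp add: isom_hom_def comp_assoc)
  qed (simp add: Z4_free_Z4_def isom_hom_def)
qed

definition stationary :: "gen list \<Rightarrow> bool" where
  "stationary g \<longleftrightarrow> g \<in> G0 \<and> isom_hom g = id"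

definition drifter :: "gen list \<Rightarrow> bool" where
  "drifter g \<longleftrightarrow> g \<in> G0 \<and> isom_hom g \<noteq> id"


section \<open>The torus \<open>\<complex>\<^sup>2 / (\<int>[\<i>])\<^sup>2\<close>\<close>

definition gauss_int :: "complex set" where
  "gauss_int = {z. Re z \<in> \<int> \<and> Im z \<in> \<int>}"

definition torus_rel :: "complex ^ 2 \<Rightarrow> complex ^ 2 \<Rightarrow> bool" where
  "torus_rel x y \<longleftrightarrow> (\<forall>k. (x - y) $ k \<in> gauss_int)"

lemma gauss_int_closed:
  "0 \<in> gauss_int"
  "a \<in> gauss_int \<Longrightarrow> - a \<in> gauss_int"
  "a \<in> gauss_int \<Longrightarrow> b \<in> gauss_int \<Longrightarrow> a + b \<in> gauss_int"
  by (auto simp: gauss_int_def)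

quotient_type torus4 = "complex ^ 2" / torus_rel
proof (rule equivpI)
  show "reflp torus_rel"
    by (simp add: reflp_def torus_rel_def gauss_int_closed)
  show "symp torus_rel"
    unfolding symp_def torus_rel_def
    by (metis gauss_int_closed(2) minus_diff_eq vector_minus_component uminus_vec_def)
  show "transp torus_rel"
    unfolding transp_def torus_rel_def
  proof (intro allI impI)
    fix x y z :: "complex ^ 2" and k
    assume "\<forall>k. (x - y) $ k \<in> gauss_int" "\<forall>k. (y - z) $ k \<in> gauss_int"
    then have "(x - y) $ k + (y - z) $ k \<in> gauss_int" by (blast intro: gauss_int_closed)
    then show "(x - z) $ k \<in> gauss_int" by simp
  qed
qed

lift_definition proj :: "complex ^ 2 \<Rightarrow> torus4" is "\<lambda>x. x" .

instantiation torus4 :: ab_group_add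
begin

lift_definition zero_torus4 :: torus4 is 0 .

lift_definition plus_torus4 :: "torus4 \<Rightarrow> torus4 \<Rightarrow> torus4" is "(+)"
  using gauss_int_closed(3) by (fastforce simp: torus_rel_def add_diff_add)

lift_definition uminus_torus4 :: "torus4 \<Rightarrow> torus4" is uminus
  using gauss_int_closed(2) by (fastforce simp: torus_rel_def)

definition minus_torus4 :: "torus4 \<Rightarrow> torus4 \<Rightarrow> torus4" where
  "minus_torus4 x y = x + - y"

instance
proof
  fix a b c :: torus4
  show "a + b + c = a + (b + c)"
    by transfer (simp add: torus_rel_def gauss_int_closed)
  show "a + b = b + a"
    by transfer (simp add: torus_rel_def gauss_int_closed)
  show "0 + a = a"
    by transfer (simp add: torus_rel_def gauss_int_closed)
  show "- a + a = 0"
    by transfer (simp add: torus_rel_def gauss_int_closed)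
  show "a - b = a + - b"
    by (rule minus_torus4_def)
qed

end

instantiation torus4 :: topological_space
begin

definition open_torus4 :: "torus4 set \<Rightarrow> bool" where
  "open_torus4 U \<longleftrightarrow> open (proj -` U)"

instance
  by standard (auto simp: open_torus4_def vimage_Union vimage_Int)

end

lemma proj_add: "proj (x + y) = proj x + proj y"
  by transfer (simp add: torus_rel_def gauss_int_closed)

lemma proj_eq_iff: "proj x = proj y \<longleftrightarrow> (\<forall>k. (x - y) $ k \<in> gauss_int)"
  by transfer (simp add: torus_rel_def)

text \<open>
  Haar-null sets: the Haar measure of the torus is Lebesgue measure on a fundamental domain of
  the lattice.
\<close>

definition torus_null :: "torus4 set \<Rightarrow> bool" where
  "torus_null N \<longleftrightarrow> negligible (proj -` N)"

definition Psi :: "real \<Rightarrow> complex \<Rightarrow> torus4" where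
  "Psi s w = proj (vector [w, w / of_real s])"

text \<open>
  For irrational \<open>s\<close> the map \<open>Psi s\<close> is injective, so that an equivariance between an action on
  \<open>\<complex>\<close> and an action on (a translate of) the image of \<open>Psi s\<close> is a conjugacy.
\<close>

lemma inj_Psi:
  assumes "s > 0" "s \<notin> \<rat>"
  shows "inj (Psi s)"
proof (rule injI)
  fix w w' assume "Psi s w = Psi s w'"
  then have g: "w - w' \<in> gauss_int" "w / of_real s - w' / of_real s \<in> gauss_int"
    by (simp_all add: Psi_def proj_eq_iff forall_2)
  have zero: "t = 0" if "t \<in> \<int>" "t / s \<in> \<int>" for t :: real
  proof (rule ccontr)
    assume "t \<noteq> 0"
    then have "s = t / (t / s)" using \<open>s > 0\<close> by simp
    moreover have "t / (t / s) \<in> \<rat>"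
      by (intro Rats_divide subsetD[OF Ints_subset_Rats] that)
    ultimately show False using \<open>s \<notin> \<rat>\<close> by metis
  qed
  have "Re (w - w') / s \<in> \<int>" "Im (w - w') / s \<in> \<int>"
    using g(2) by (simp_all add: gauss_int_def diff_divide_distrib)
  moreover have "Re (w - w') \<in> \<int>" "Im (w - w') \<in> \<int>"
    using g(1) by (simp_all add: gauss_int_def)
  ultimately have "Re (w - w') = 0" "Im (w - w') = 0"
    using zero by blast+
  then show "w = w'" by (simp add: complex_eq_iff)
qed

definition is_translation :: "(torus4 \<Rightarrow> torus4) \<Rightarrow> bool" where
  "is_translation \<tau> \<longleftrightarrow> (\<exists>t. \<tau> = (\<lambda>p. p + t))"


section \<open>Piecewise affine maps\<close>

text \<open>
  A polytope of the torus is represented by a lift, a full-dimensional convex polytope of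
  \<open>\<complex>\<^sup>2 = \<real>\<^sup>4\<close> whose interior embeds in the torus.
\<close>

definition torus_partition :: "(complex ^ 2) set set \<Rightarrow> bool" where
  "torus_partition \<P> \<longleftrightarrow>
     finite \<P> \<and>
     (\<forall>P\<in>\<P>. polytope P \<and> interior P \<noteq> {} \<and> inj_on proj (interior P)) \<and>
     pairwise (\<lambda>P Q. disjnt (proj ` interior P) (proj ` interior Q)) \<P> \<and>
     (\<Union>P\<in>\<P>. proj ` P) = UNIV"

text \<open>Affine means real affine; complex linearity is a separate property.\<close>

definition piecewise_affine :: "(torus4 \<rightharpoonup> torus4) \<Rightarrow> bool" where
  "piecewise_affine f \<longleftrightarrow>
     (\<exists>\<P>. torus_partition \<P> \<and>
       (\<forall>P\<in>\<P>. \<exists>M b. linear M \<and> (\<forall>x\<in>interior P. f (proj x) = Some (proj (M x + b)))))"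

definition piecewise_translation :: "(torus4 \<rightharpoonup> torus4) \<Rightarrow> bool" where
  "piecewise_translation f \<longleftrightarrow>
     (\<exists>\<P>. torus_partition \<P> \<and>
       (\<forall>P\<in>\<P>. \<exists>b. \<forall>x\<in>interior P. f (proj x) = Some (proj (x + b))))"

definition polytope_exchange :: "(torus4 \<rightharpoonup> torus4) \<Rightarrow> bool" where
  "polytope_exchange f \<longleftrightarrow>
     piecewise_translation f \<and> inj_on f (dom f) \<and>
     closure (ran f) = UNIV \<and> torus_null (- ran f)"

text \<open>\<open>has_linear_part f p M\<close>: near \<open>p\<close>, the map \<open>f\<close> is affine with linear part \<open>M\<close>.\<close>

definition has_linear_part ::
    "(torus4 \<rightharpoonup> torus4) \<Rightarrow> torus4 \<Rightarrow> (complex ^ 2 \<Rightarrow> complex ^ 2) \<Rightarrow> bool" where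
  "has_linear_part f p M \<longleftrightarrow>
     linear M \<and> (\<exists>q. \<forall>\<^sub>F v in nhds 0. f (p + proj v) = Some (q + proj (M v)))"

text \<open>A piecewise affine map has a linear part at each point interior to a piece.\<close>

lemma has_linear_part_interior:
  assumes "linear M" "\<And>x. x \<in> interior P \<Longrightarrow> f (proj x) = Some (proj (M x + b))"
    and "x \<in> interior P"
  shows "has_linear_part f (proj x) M"
proof -
  have "open ((\<lambda>v. x + v) -` interior P)"
    by (intro open_vimage continuous_intros) auto
  then have "\<forall>\<^sub>F v in nhds 0. x + v \<in> interior P"
    using assms(3) by (auto simp: eventually_nhds intro!: exI[of _ "(\<lambda>v. x + v) -` interior P"])
  then have "\<forall>\<^sub>F v in nhds 0. f (proj x + proj v) = Some (proj (M x + b) + proj (M v))"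
  proof eventually_elim
    case (elim v)
    have "M (x + v) + b = (M x + b) + M v"
      using \<open>linear M\<close> by (simp add: linear_add)
    then show ?case using assms(2)[OF elim] by (simp add: proj_add)
  qed
  with \<open>linear M\<close> show ?thesis by (auto simp: has_linear_part_def)
qed

text \<open>Equality wherever both sides are defined.\<close>

definition agree :: "('a \<rightharpoonup> 'b) \<Rightarrow> ('a \<rightharpoonup> 'b) \<Rightarrow> bool" where
  "agree f g \<longleftrightarrow> (\<forall>x \<in> dom f \<inter> dom g. f x = g x)"

definition piecewise_affine_action :: "(gen list \<Rightarrow> torus4 \<rightharpoonup> torus4) \<Rightarrow> bool" where
  "piecewise_affine_action F \<longleftrightarrow>
     (\<forall>g\<in>carrier G4. piecewise_affine (F g)) \<and>
     agree (F \<one>\<^bsub>G4\<^esub>) Some \<and>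
     (\<forall>g\<in>carrier G4. \<forall>h\<in>carrier G4. agree (F (g \<otimes>\<^bsub>G4\<^esub> h)) (F g \<circ>\<^sub>m F h))"

definition nontrivial_complex_parabolic :: "(complex ^ 2 \<Rightarrow> complex ^ 2) \<Rightarrow> bool" where
  "nontrivial_complex_parabolic M \<longleftrightarrow>
     Vector_Spaces.linear (*s) (*s) M \<and>
     (\<forall>c v. v \<noteq> 0 \<and> M v = c *s v \<longrightarrow> c = 1) \<and>
     M \<noteq> id"

end

theory Submission
  imports Defs
begin

text \<open>
  In the coordinates \<open>(w, (w - z) / s)\<close> the positions of \<open>w\<close> inside its squares of the two grids
  are the fractional parts of the two coordinates, and turning \<open>w\<close> displaces it by an affine
  function of one of these fractional parts.  Hence each square turning map extends to the torus as
  \<open>x \<mapsto> x + \<delta>(x\<^sub>k) \<cdot> d\<close> with a periodic \<open>\<delta>\<close> and \<open>d\<close> parallel to \<open>(1, 1/s)\<close>; its linear part multiplies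
  \<open>(1, 1/s)\<close> by \<open>-\<i>\<close> and is the identity modulo that vector.  The linear parts thus act on an affine
  line by clockwise quarter turns about two points, which is the complex conjugate of the
  homomorphism to \<open>Isom(\<complex>)\<close> up to scaling: a word of \<open>G0\<close> acts linearly as a shear along \<open>(1, 1/s)\<close>
  whose coefficient is the conjugate of its translation vector.
\<close>

section \<open>Square turning maps on the torus\<close>

text \<open>
  On the grid lines the turning maps are extended by the identity.  This makes them bijections of
  order exactly four, so that the action relations hold everywhere.
\<close>

definition turn_disp :: "complex \<Rightarrow> complex" where
  "turn_disp \<zeta> = (if Re \<zeta> \<in> \<int> \<or> Im \<zeta> \<in> \<int> then 0
     else - (1 + \<i>) * Complex (frac (Re \<zeta>) - 1/2) (frac (Im \<zeta>) - 1/2))"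

lemma between_ints_notin_Ints:
  fixes t :: real
  assumes "of_int m < t" "t < of_int m + 1"
  shows "t \<notin> \<int>" "frac t = t - of_int m"
proof -
  have "\<lfloor>t\<rfloor> = m"
    using assms by linarith
  then show "frac t = t - of_int m"
    by (simp add: frac_def)
  show "t \<notin> \<int>"
    using assms frac_eq_0_iff[of t] by (simp add: \<open>frac t = t - of_int m\<close>)
qed

text \<open>A clockwise quarter turn multiplies the offset from the centre by \<open>- \<i>\<close>,
  so the displacement is \<open>- \<i> - 1\<close> times that offset.\<close>

lemma turn_disp_eq:
  assumes "of_int m < Re \<zeta>" "Re \<zeta> < of_int m + 1" "of_int n < Im \<zeta>" "Im \<zeta> < of_int n + 1"
  shows "turn_disp \<zeta> = - (1 + \<i>) * (\<zeta> - Complex (of_int m + 1/2) (of_int n + 1/2))"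
  using between_ints_notin_Ints[OF assms(1,2)] between_ints_notin_Ints[OF assms(3,4)]
  by (simp add: turn_disp_def complex_eq_iff)

lemma turn_disp_boundary: "Re \<zeta> \<in> \<int> \<or> Im \<zeta> \<in> \<int> \<Longrightarrow> turn_disp \<zeta> = 0"
  by (simp add: turn_disp_def)

lemma between_ints_exists:
  fixes t :: real
  assumes "t \<notin> \<int>"
  obtains m :: int where "of_int m < t" "t < of_int m + 1"
proof
  show "of_int \<lfloor>t\<rfloor> < t"
    using assms by (metis Ints_of_int of_int_floor_le order_le_less)
qed linarith

lemma turn_disp_periodic:
  assumes "\<eta> \<in> gauss_int"
  shows "turn_disp (\<zeta> + \<eta>) = turn_disp \<zeta>"
proof -
  obtain m n :: int where mn: "Re \<eta> = of_int m" "Im \<eta> = of_int n"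
    using assms by (auto simp: gauss_int_def elim!: Ints_cases)
  have "t + of_int k \<in> \<int> \<longleftrightarrow> t \<in> \<int>" for t :: real and k
    by (metis Ints_add Ints_diff Ints_of_int add_diff_cancel)
  moreover have "frac (t + of_int k) = frac t" for t :: real and k
    by (simp add: frac_def)
  ultimately show ?thesis
    by (simp add: turn_disp_def mn)
qed

text \<open>The turned point stays in the same open unit square, so the centre is unchanged and the
  offset, hence the displacement, gets multiplied by \<open>- \<i>\<close>. On grid lines both sides
  vanish.\<close>

lemma turn_disp_turn: "turn_disp (\<zeta> + turn_disp \<zeta>) = - \<i> * turn_disp \<zeta>"
proof (cases "Re \<zeta> \<in> \<int> \<or> Im \<zeta> \<in> \<int>")
  case False
  then obtain m n :: int where mn: "of_int m < Re \<zeta>" "Re \<zeta> < of_int m + 1" "of_int n < Im \<zeta>" "Im \<zeta> < of_int n + 1"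
    by (meson between_ints_exists)
  note eq = turn_disp_eq[OF mn]
  have "turn_disp (\<zeta> + turn_disp \<zeta>)
      = - (1 + \<i>) * (\<zeta> + turn_disp \<zeta> - Complex (of_int m + 1/2) (of_int n + 1/2))"
    by (rule turn_disp_eq) (use mn in \<open>simp_all add: eq\<close>)
  then show ?thesis
    by (simp add: eq complex_eq_iff algebra_simps)
qed (simp add: turn_disp_boundary)

primrec coord :: "gen \<Rightarrow> 2" where
  "coord A1 = 1"
| "coord A2 = 2"

text \<open>Both directions are multiples of \<open>(1, 1/s)\<close>, scaled so that the coordinate
  selected by \<open>coord\<close> moves by exactly \<open>turn_disp\<close>. A square of side
  \<open>s\<close> is a unit square in the second coordinate, hence the factor \<open>s\<close> for
  \<open>A2\<close>.\<close>

primrec disp_dir :: "real \<Rightarrow> gen \<Rightarrow> complex ^ 2" where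
  "disp_dir s A1 = vector [1, 1 / of_real s]"
| "disp_dir s A2 = vector [of_real s, 1]"

lemma disp_dir_coord [simp]: "disp_dir s a $ coord a = 1"
  by (cases a) auto

lift_definition torus_turn :: "real \<Rightarrow> gen \<Rightarrow> torus4 \<Rightarrow> torus4" is
  "\<lambda>s a x. x + turn_disp (x $ coord a) *s disp_dir s a"
proof -
  fix s :: real and a and x y :: "complex ^ 2"
  assume r: "torus_rel x y"
  then have "turn_disp (y $ coord a + (x - y) $ coord a) = turn_disp (y $ coord a)"
    by (intro turn_disp_periodic) (simp add: torus_rel_def)
  with r show "torus_rel (x + turn_disp (x $ coord a) *s disp_dir s a)
                 (y + turn_disp (y $ coord a) *s disp_dir s a)"
    by (simp add: torus_rel_def)
qed

lemma torus_turn_proj: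
  "torus_turn s a (proj x) = proj (x + turn_disp (x $ coord a) *s disp_dir s a)"
  by transfer (simp add: torus_rel_def gauss_int_closed)

lemma proj_surj: obtains x where "p = proj x"
  by (metis Quotient_abs_rep[OF Quotient_torus4] proj.abs_eq)

text \<open>The four successive displacements are \<open>d\<close>, \<open>- \<i> * d\<close>,
  \<open>- d\<close> and \<open>\<i> * d\<close>, which sum to zero.\<close>

lemma torus_turn_4: "torus_turn s a (torus_turn s a (torus_turn s a (torus_turn s a p))) = p"
proof -
  obtain x where p: "p = proj x" by (rule proj_surj)
  \<comment> \<open>The orbit stays on the complex line through the point in direction
    \<open>disp_dir s a\<close>, so a scalar \<open>c\<close> suffices to track it.\<close>
  have step: "torus_turn s a (proj (y + c *s disp_dir s a))
      = proj (y + (c + turn_disp (y $ coord a + c)) *s disp_dir s a)" for y c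
    by (simp add: torus_turn_proj vec.scale_left_distrib add.assoc)
  define d where "d = turn_disp (x $ coord a)"
  have d1: "turn_disp (x $ coord a + d) = - \<i> * d"
    using turn_disp_turn[of "x $ coord a"] by (simp add: d_def)
  have d2: "turn_disp (x $ coord a + (d + - \<i> * d)) = - d"
    using turn_disp_turn[of "x $ coord a + d"] unfolding d1 by (simp add: algebra_simps)
  have d3: "turn_disp (x $ coord a + (d + - \<i> * d + - d)) = \<i> * d"
    using turn_disp_turn[of "x $ coord a + (d + - \<i> * d)"] unfolding d2 by (simp add: algebra_simps)
  have "torus_turn s a p = proj (x + d *s disp_dir s a)"
    by (simp add: p torus_turn_proj d_def)
  then have "torus_turn s a (torus_turn s a (torus_turn s a (torus_turn s a p)))
      = proj (x + (d + - \<i> * d + - d + \<i> * d) *s disp_dir s a)"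
    by (simp only: step d1 d2 d3)
  then show ?thesis by (simp add: p)
qed

section \<open>The action of the free product on the torus and its equivariance\<close>

definition torus_act :: "real \<Rightarrow> gen list \<Rightarrow> torus4 \<Rightarrow> torus4" where
  "torus_act s g = foldr (\<lambda>a f. torus_turn s a \<circ> f) g id"

lemma torus_act_simps [simp]:
  "torus_act s [] = id" "torus_act s (a # g) = torus_turn s a \<circ> torus_act s g"
  by (simp_all add: torus_act_def)

lemma bij_torus_act: "bij (torus_act s g)"
proof (induction g)
  case (Cons a g)
  \<comment> \<open>Since a turn has fourth power the identity, its cube is a two-sided
    inverse.\<close>
  have "bij (torus_turn s a)"
    by (rule o_bij[of "torus_turn s a \<circ> torus_turn s a \<circ> torus_turn s a"])
      (simp_all add: fun_eq_iff torus_turn_4)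
  then show ?case
    unfolding torus_act_simps using Cons.IH by (intro bij_comp)
next
  case Nil
  show ?case unfolding torus_act_simps by (rule bij_id)
qed

lemma torus_act_push: "torus_act s (push a w) = torus_turn s a \<circ> torus_act s w"
proof (cases "take 3 w = replicate 3 a")
  case True
  then obtain t where "w = a # a # a # t" by (metis take_3_replicate)
  then show ?thesis by (simp add: push_def fun_eq_iff torus_turn_4 numeral_eq_Suc)
qed (simp add: push_def)

lemma torus_act_mult: "torus_act s (u \<otimes>\<^bsub>G4\<^esub> v) = torus_act s u \<circ> torus_act s v"
proof -
  have "torus_act s (foldr push u v) = torus_act s u \<circ> torus_act s v"
    by (induction u) (auto simp: torus_act_push)
  then show ?thesis by (simp add: Z4_free_Z4_def)
qed

text \<open>In the coordinates \<open>w\<close> and \<open>(w - z) / s\<close> each of the two grids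
  becomes the unit grid of its own coordinate. A definite value \<open>Some w'\<close> places
  \<open>w\<close> inside an open square, where the turn is given by
  \<open>turn_disp_eq\<close>.\<close>

lemma torus_turn_Psi:
  assumes "s > 0" and "turn_gen s z a w = Some w'"
  shows "torus_turn s a (proj (vector [w, (w - z) / of_real s])) = proj (vector [w', (w' - z) / of_real s])"
proof (cases a)
  case A1
  with assms(2) obtain m n where mn: "w \<in> interior (grid_square 1 0 m n)"
    by (auto simp: square_turn_def split: if_splits)
  then have "w' = rotation (- pi / 2) (square_center 1 0 m n) w"
    using assms(2) square_turn_eq[OF _ mn] A1 by simp
  moreover have "turn_disp w = - (1 + \<i>) * (w - Complex (of_int m + 1/2) (of_int n + 1/2))"
    using mn by (intro turn_disp_eq) (simp_all add: interior_grid_square)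
  ultimately have w': "w' = w + turn_disp w"
    by (simp add: rotation_def square_center_def algebra_simps complex_eq_iff)
  show ?thesis
    unfolding torus_turn_proj
    by (rule arg_cong[where f = proj])
      (simp add: A1 w' vec_eq_iff forall_2 add_divide_distrib diff_divide_distrib)
next
  case A2
  with assms(2) obtain m n where mn: "w \<in> interior (grid_square s z m n)"
    by (auto simp: square_turn_def split: if_splits)
  then have "w' = rotation (- pi / 2) (square_center s z m n) w"
    using assms square_turn_eq[OF assms(1) mn] A2 by simp
  moreover have "turn_disp ((w - z) / of_real s)
      = - (1 + \<i>) * ((w - z) / of_real s - Complex (of_int m + 1/2) (of_int n + 1/2))"
    using mn assms(1) by (intro turn_disp_eq) (simp_all add: interior_grid_square field_simps)
  ultimately have w': "w' = w + of_real s * turn_disp ((w - z) / of_real s)"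
    using assms(1)
    by (simp add: rotation_def square_center_def field_simps complex_eq_iff)
  show ?thesis
    unfolding torus_turn_proj using assms(1)
    by (intro arg_cong[where f = proj]) (simp add: A2 w' vec_eq_iff forall_2 field_simps)
qed

lemma torus_act_Psi:
  assumes "s > 0"
  shows "square_action s z g w = Some w' \<Longrightarrow>
    torus_act s g (proj (vector [w, (w - z) / of_real s])) = proj (vector [w', (w' - z) / of_real s])"
proof (induction g arbitrary: w')
  case (Cons a g)
  then obtain u where "square_action s z g w = Some u" "turn_gen s z a u = Some w'"
    by (auto simp: square_action_def map_comp_Some_iff)
  then show ?case using Cons.IH torus_turn_Psi[OF assms] by simp
qed (simp add: square_action_def)

section \<open>Linear parts\<close>

text \<open>This is the derivative of \<open>torus_turn\<close>: \<open>turn_disp\<close> has slope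
  \<open>- (1 + \<i>)\<close> on every open unit square, whichever square it is.\<close>

definition turn_linear :: "real \<Rightarrow> gen \<Rightarrow> complex ^ 2 \<Rightarrow> complex ^ 2" where
  "turn_linear s a v = v - ((1 + \<i>) * v $ coord a) *s disp_dir s a"

definition act_linear :: "real \<Rightarrow> gen list \<Rightarrow> complex ^ 2 \<Rightarrow> complex ^ 2" where
  "act_linear s g = foldr (\<lambda>a f. turn_linear s a \<circ> f) g id"

lemma act_linear_simps [simp]:
  "act_linear s [] v = v" "act_linear s (a # g) v = turn_linear s a (act_linear s g v)"
  by (simp_all add: act_linear_def)

lemma linear_turn_linear: "linear (turn_linear s a)"
  by (rule linearI) (simp_all add: turn_linear_def vec_eq_iff algebra_simps)

lemma linear_act_linear: "linear (act_linear s g)"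
proof (induction g)
  case (Cons a g)
  have "act_linear s (a # g) = turn_linear s a \<circ> act_linear s g"
    by (simp add: fun_eq_iff)
  then show ?case
    using linear_compose[OF Cons.IH linear_turn_linear] by metis
qed (simp add: act_linear_def id_def linear_ident)

text \<open>Surjectivity ensures later that the coordinates of \<open>act_linear s g\<close> are
  nonconstant, so that the grid can be pulled back to genuine hyperplanes.\<close>

lemma surj_act_linear: "surj (act_linear s g)"
proof (induction g)
  case (Cons a g)
  \<comment> \<open>The preimage is the counterclockwise turn of \<open>y\<close>: it multiplies the
    selected coordinate by \<open>\<i>\<close>.\<close>
  have "turn_linear s a (y + ((\<i> - 1) * y $ coord a) *s disp_dir s a) = y" for y
    by (simp add: turn_linear_def vec_eq_iff algebra_simps)
  then have "surj (turn_linear s a)" by (rule surjI)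
  then show ?case using comp_surj[OF Cons.IH] by (simp add: act_linear_def)
qed (simp add: act_linear_def)

section \<open>Comparison with the homomorphism to the plane isometries\<close>

lemma isom_hom_Cons: "isom_hom (a # g) w = rot_gen a (isom_hom g w)"
  by (simp add: isom_hom_def)

lemma isom_hom_affine: "isom_hom g w = \<i> ^ length g * w + isom_hom g 0"
proof (induction g)
  case (Cons a g)
  then show ?case
    by (cases a) (simp_all add: isom_hom_Cons rotation_def algebra_simps)
qed (simp add: isom_hom_def)

text \<open>Every turn adds a multiple of \<open>(1, 1/s)\<close>, so the second summand, which
  represents \<open>v\<close> modulo that vector, never changes. With
  \<open>l = v $ 1 - of_real s * v $ 2\<close>, the coefficient \<open>c\<close> of that vector
  becomes \<open>- \<i> * c\<close> under \<open>A1\<close> and \<open>l - \<i> * (c - l)\<close>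
  under \<open>A2\<close>. For nonzero \<open>l\<close> the ratio \<open>c / l\<close> thus
  undergoes clockwise quarter turns about 0 and 1, the conjugates of \<open>rot_gen\<close>.\<close>

lemma act_linear_formula:
  assumes "s \<noteq> 0"
  shows "act_linear s g v =
    ((- \<i>) ^ length g * v $ 1 + (v $ 1 - of_real s * v $ 2) * cnj (isom_hom g 0)) *s vector [1, 1 / of_real s]
    + vector [0, v $ 2 - v $ 1 / of_real s]"
  (is "_ = ?R g")
proof (induction g)
  case Nil
  show ?case using assms by (simp add: isom_hom_def vec_eq_iff forall_2)
next
  case (Cons a g)
  define h where "h = cnj (isom_hom g 0)"
  define q where "q = (- \<i>) ^ length g"
  have h': "cnj (isom_hom (a # g) 0) = (case a of A1 \<Rightarrow> - \<i> * h | A2 \<Rightarrow> 1 - \<i> * (h - 1))"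
    by (cases a) (simp_all add: isom_hom_Cons rotation_def h_def)
  have "act_linear s (a # g) v = turn_linear s a
      ((q * v $ 1 + (v $ 1 - of_real s * v $ 2) * h) *s vector [1, 1 / of_real s]
        + vector [0, v $ 2 - v $ 1 / of_real s])"
    by (simp only: act_linear_simps Cons q_def h_def)
  also have "\<dots> = (- \<i> * q * v $ 1 + (v $ 1 - of_real s * v $ 2) *
        (case a of A1 \<Rightarrow> - \<i> * h | A2 \<Rightarrow> 1 - \<i> * (h - 1))) *s vector [1, 1 / of_real s]
      + vector [0, v $ 2 - v $ 1 / of_real s]"
    using assms
    by (cases a) (simp_all add: turn_linear_def vec_eq_iff forall_2 field_simps)
  finally show ?case
    by (simp only: h' q_def length_Cons power_Suc)
qed

text \<open>A length divisible by four makes the rotational factor 1, which leaves a shear along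
  \<open>(1, 1/s)\<close>.\<close>

lemma act_linear_G0:
  assumes "s \<noteq> 0" "g \<in> G0"
  shows "act_linear s g v =
    v + ((v $ 1 - of_real s * v $ 2) * cnj (isom_hom g 0)) *s vector [1, 1 / of_real s]"
proof -
  obtain k where "length g = 4 * k" using assms(2) by (auto simp: G0_def)
  then have "(- \<i>) ^ length g = 1" by (simp add: power_mult)
  with assms(1) show ?thesis
    by (simp add: act_linear_formula vec_eq_iff forall_2 field_simps)
qed

lemma isom_hom_eq_id_iff:
  assumes "g \<in> G0"
  shows "isom_hom g = id \<longleftrightarrow> isom_hom g 0 = 0"
proof -
  obtain k where "length g = 4 * k" using assms by (auto simp: G0_def)
  then have "\<i> ^ length g = 1" by (simp add: power_mult)
  then have *: "isom_hom g w = w + isom_hom g 0" for w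
    using isom_hom_affine[of g w] by simp
  show ?thesis
  proof
    assume "isom_hom g 0 = 0"
    then have "isom_hom g w = id w" for w using *[of w] by simp
    then show "isom_hom g = id" by blast
  qed simp
qed

lemma act_linear_stationary:
  assumes "s \<noteq> 0" "stationary g"
  shows "act_linear s g = id"
proof -
  have g: "g \<in> G0" "isom_hom g 0 = 0" using assms(2) by (auto simp: stationary_def)
  then show ?thesis by (simp add: act_linear_G0[OF assms(1)] fun_eq_iff)
qed

text \<open>The map is a transvection \<open>v + (l v * d) *s v0\<close> with
  \<open>l v0 = 0\<close> and \<open>d\<close> nonzero, so its fixed space is the kernel of
  \<open>l\<close>, the line spanned by \<open>v0\<close>.\<close>

lemma act_linear_drifter:
  assumes "s \<noteq> 0" "drifter g"
  shows "nontrivial_complex_parabolic (act_linear s g)"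
    and "{v. act_linear s g v = v} = vec.span {vector [1, 1 / of_real s]}"
proof -
  define d where "d = cnj (isom_hom g 0)"
  have g: "g \<in> G0" and d: "d \<noteq> 0"
    using assms(2) isom_hom_eq_id_iff by (auto simp: drifter_def d_def)
  define l where "l = (\<lambda>v :: complex ^ 2. v $ 1 - of_real s * v $ 2)"
  define v0 :: "complex ^ 2" where "v0 = vector [1, 1 / of_real s]"
  have L: "act_linear s g v = v + (l v * d) *s v0" for v
    using act_linear_G0[OF assms(1) g] by (simp add: l_def d_def v0_def)
  have v0: "v0 \<noteq> 0" by (simp add: v0_def vec_eq_iff forall_2)
  have l_v0: "l v0 = 0" using assms(1) by (simp add: l_def v0_def)
  have l_add: "l (v + w) = l v + l w" and l_scale: "l (c *s v) = c * l v" for c v w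
    by (simp_all add: l_def algebra_simps)
  have fix_iff: "act_linear s g v = v \<longleftrightarrow> l v = 0" for v
    using d v0 by (simp add: L vec.scale_eq_0_iff)
  have "c = 1" if v: "v \<noteq> 0" "act_linear s g v = c *s v" for c v
  proof -
    \<comment> \<open>The functional \<open>l\<close> is invariant. An eigenvector outside its
      kernel therefore has eigenvalue 1, and one inside it is fixed.\<close>
    have "l v = l (act_linear s g v)" by (simp add: L l_add l_scale l_v0)
    also have "\<dots> = c * l v" using v by (simp add: l_scale)
    finally have "c = 1 \<or> l v = 0" by auto
    moreover have "c = 1" if "l v = 0"
      using that v fix_iff[of v] by (metis vec.scale_cancel_right vec.scale_one)
    ultimately show ?thesis by blast
  qed
  moreover have "act_linear s g \<noteq> id"
  proof -
    have "l (vector [1, 0]) \<noteq> 0" by (simp add: l_def)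
    then show ?thesis using fix_iff by (metis id_apply)
  qed
  moreover have "Vector_Spaces.linear (*s) (*s) (act_linear s g)"
    by unfold_locales (simp_all add: L l_add l_scale vec_eq_iff algebra_simps)
  ultimately show "nontrivial_complex_parabolic (act_linear s g)"
    by (auto simp: nontrivial_complex_parabolic_def)
  have "l v = 0 \<longleftrightarrow> (\<exists>k. v = k *s v0)" for v
  proof
    assume "l v = 0"
    then have "v = (v $ 1) *s v0"
      using assms(1) by (simp add: l_def v0_def vec_eq_iff forall_2 field_simps)
    then show "\<exists>k. v = k *s v0" by blast
  qed (auto simp: l_scale l_v0)
  then show "{v. act_linear s g v = v} = vec.span {vector [1, 1 / of_real s]}"
    unfolding fix_iff vec.span_singleton v0_def[symmetric] by auto
qed

section \<open>Subdivisions of the unit cube\<close>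

definition subdivision :: "'a::euclidean_space set set \<Rightarrow> 'a set \<Rightarrow> bool" where
  "subdivision \<P> C \<longleftrightarrow> finite \<P> \<and> (\<forall>P\<in>\<P>. polytope P \<and> interior P \<noteq> {}) \<and>
     pairwise (\<lambda>P Q. disjnt (interior P) (interior Q)) \<P> \<and> \<Union>\<P> = C"

text \<open>New pieces of different old pieces have disjoint interiors because each lies in the
  interior of its old piece. The predicate \<open>\<Phi>\<close> carries whatever the refinement
  achieves.\<close>

lemma subdivision_refine:
  assumes "subdivision \<P> C"
    and ref: "\<And>P. P \<in> \<P> \<Longrightarrow> \<exists>\<Q>. subdivision \<Q> P \<and> (\<forall>Q\<in>\<Q>. \<Phi> Q)"
  shows "\<exists>\<Q>. subdivision \<Q> C \<and> (\<forall>Q\<in>\<Q>. \<Phi> Q)"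
proof -
  obtain f where f: "\<And>P. P \<in> \<P> \<Longrightarrow> subdivision (f P) P" "\<And>P Q. P \<in> \<P> \<Longrightarrow> Q \<in> f P \<Longrightarrow> \<Phi> Q"
    using ref by metis
  have sub: "interior Q \<subseteq> interior P" if "P \<in> \<P>" "Q \<in> f P" for P Q
    using f(1)[OF that(1)] that(2) by (intro interior_mono) (auto simp: subdivision_def)
  have "disjnt (interior Q) (interior Q')"
    if "P \<in> \<P>" "Q \<in> f P" "P' \<in> \<P>" "Q' \<in> f P'" "Q \<noteq> Q'" for P P' Q Q'
  proof (cases "P = P'")
    case True
    then show ?thesis using that f(1)[of P] by (auto simp: subdivision_def pairwise_def)
  next
    case False
    then have "disjnt (interior P) (interior P')"
      using that assms(1) by (auto simp: subdivision_def pairwise_def)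
    then show ?thesis using that sub[of P Q] sub[of P' Q'] by (auto simp: disjnt_def)
  qed
  then have "pairwise (\<lambda>P Q. disjnt (interior P) (interior Q)) (\<Union>P\<in>\<P>. f P)"
    unfolding pairwise_def by blast
  moreover have "\<Union> (\<Union>P\<in>\<P>. f P) = (\<Union>P\<in>\<P>. \<Union> (f P))" by blast
  moreover have "(\<Union>P\<in>\<P>. \<Union> (f P)) = C"
    using f(1) assms(1) by (auto simp: subdivision_def)
  ultimately have "subdivision (\<Union>P\<in>\<P>. f P) C"
    using f(1) assms(1) by (auto simp: subdivision_def)
  then show ?thesis using f(2) by blast
qed

text \<open>The polytope is cut along the parallel hyperplanes where
  \<open>a \<bullet> x + c\<close> is an integer; boundedness leaves finitely many slabs.\<close>

lemma subdivision_slabs: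
  fixes a :: "'a::euclidean_space"
  assumes P: "polytope P" "interior P \<noteq> {}" and "a \<noteq> 0"
  shows "\<exists>\<Q>. subdivision \<Q> P \<and>
    (\<forall>Q\<in>\<Q>. \<exists>m::int. \<forall>x\<in>interior Q. of_int m < a \<bullet> x + c \<and> a \<bullet> x + c < of_int m + 1)"
proof -
  define S where "S m = P \<inter> ({x. a \<bullet> x \<ge> of_int m - c} \<inter> {x. a \<bullet> x \<le> of_int m + 1 - c})" for m :: int
  have int_S: "interior (S m) = interior P \<inter> {x. of_int m < a \<bullet> x + c \<and> a \<bullet> x + c < of_int m + 1}" for m
    using \<open>a \<noteq> 0\<close> by (auto simp: S_def interior_Int interior_halfspace_le interior_halfspace_ge)
  \<comment> \<open>A slab that only touches \<open>P\<close> in a face is dropped, since pieces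
    must have nonempty interior.\<close>
  define \<Q> where "\<Q> = S ` {m. interior (S m) \<noteq> {}}"
  have poly: "polytope (S m)" for m
    unfolding S_def using P
    by (intro polytope_Int_polyhedron polyhedron_Int polyhedron_halfspace_le polyhedron_halfspace_ge)
  have "bounded ((\<lambda>x. a \<bullet> x + c) ` P)"
    using P(1) by (intro compact_imp_bounded compact_continuous_image continuous_intros polytope_imp_compact)
  then obtain K where K: "\<And>x. x \<in> P \<Longrightarrow> \<bar>a \<bullet> x + c\<bar> \<le> K"
    by (auto simp: bounded_iff)
  have "{m. interior (S m) \<noteq> {}} \<subseteq> {\<lfloor>- K\<rfloor> - 1..\<lceil>K\<rceil>}"
  proof
    fix m assume "m \<in> {m. interior (S m) \<noteq> {}}"
    then obtain x where "x \<in> interior (S m)" by blast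
    then have "x \<in> P" "of_int m < a \<bullet> x + c" "a \<bullet> x + c < of_int m + 1"
      using interior_subset by (auto simp: int_S)
    then show "m \<in> {\<lfloor>- K\<rfloor> - 1..\<lceil>K\<rceil>}" using K[of x] by auto linarith+
  qed
  then have fin: "finite \<Q>"
    unfolding \<Q>_def by (intro finite_imageI) (auto intro: finite_subset)
  have disj: "m = m'" if "x \<in> interior (S m)" "x \<in> interior (S m')" for x m m'
    using that by (simp add: int_S)
  \<comment> \<open>Dropping flat slabs must lose no point. The finitely many closed pieces leave an
    open set uncovered, which would meet \<open>interior P\<close>; from there a small push along
    \<open>a\<close> reaches a retained slab.\<close>
  have "P \<subseteq> \<Union>\<Q>"
  proof (rule ccontr)
    assume "\<not> P \<subseteq> \<Union>\<Q>"
    then obtain x where x: "x \<in> P" "x \<notin> \<Union>\<Q>" by blast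
    have "closed (\<Union>\<Q>)"
      using fin poly by (intro closed_Union) (auto simp: \<Q>_def intro: polytope_imp_closed)
    then have op: "open (- \<Union>\<Q>)" by (simp add: open_Compl)
    have "closure (interior P) = P"
      using P by (simp add: convex_closure_interior polytope_imp_convex polytope_imp_closed)
    then have "- \<Union>\<Q> \<inter> interior P \<noteq> {}"
      using x op open_Int_closure_eq_empty[of "- \<Union>\<Q>" "interior P"] by auto
    then obtain y where y: "y \<in> - \<Union>\<Q> \<inter> interior P" by blast
    moreover have "open (- \<Union>\<Q> \<inter> interior P)" using op by (intro open_Int open_interior)
    ultimately obtain e where e: "e > 0" "ball y e \<subseteq> - \<Union>\<Q> \<inter> interior P"
      by (meson open_contains_ball)
    define m where "m = \<lfloor>a \<bullet> y + c\<rfloor>"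
    define r where "r = of_int m + 1 - (a \<bullet> y + c)"
    have r: "r > 0" unfolding r_def m_def by linarith
    have na: "norm a > 0" using \<open>a \<noteq> 0\<close> by simp
    \<comment> \<open>The first bound keeps the pushed point in the ball, the second keeps the
      functional below \<open>m + 1\<close>. The push makes its value exceed \<open>m\<close>
      strictly even if it was an integer at \<open>y\<close>.\<close>
    define t where "t = min (e / 2 / norm a) (r / 2 / (norm a)\<^sup>2)"
    have t: "t > 0" "t * norm a < e" "t * (norm a)\<^sup>2 < r"
    proof -
      show "t > 0" using e(1) r na by (simp add: t_def)
      have "t * norm a \<le> e / 2 / norm a * norm a"
        using na by (intro mult_right_mono) (auto simp: t_def)
      then show "t * norm a < e" using na e(1) by simp
      have "t * (norm a)\<^sup>2 \<le> r / 2 / (norm a)\<^sup>2 * (norm a)\<^sup>2"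
        by (intro mult_right_mono) (auto simp: t_def)
      then show "t * (norm a)\<^sup>2 < r" using na r by simp
    qed
    let ?y = "y + t *\<^sub>R a"
    have "?y \<in> ball y e" using t by (simp add: dist_norm)
    with e(2) have y': "?y \<in> interior P" "?y \<notin> \<Union>\<Q>" by auto
    have "a \<bullet> ?y + c = a \<bullet> y + c + t * (norm a)\<^sup>2"
      by (simp add: inner_add_right power2_norm_eq_inner)
    moreover have "t * (norm a)\<^sup>2 > 0" using t(1) na by simp
    moreover have "of_int m \<le> a \<bullet> y + c" by (simp add: m_def)
    ultimately have "?y \<in> interior (S m)"
      using y'(1) t(3) by (simp add: int_S r_def)
    then have "S m \<in> \<Q>" "?y \<in> S m" using interior_subset by (auto simp: \<Q>_def)
    with y'(2) show False by blast
  qed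
  moreover have "\<Union>\<Q> \<subseteq> P" by (auto simp: \<Q>_def S_def)
  moreover have "pairwise (\<lambda>P Q. disjnt (interior P) (interior Q)) \<Q>"
    using disj by (auto simp: pairwise_def \<Q>_def disjnt_def)
  ultimately have "subdivision \<Q> P"
    using fin poly by (auto simp: subdivision_def \<Q>_def)
  moreover have "\<forall>Q\<in>\<Q>. \<exists>m::int. \<forall>x\<in>interior Q. of_int m < a \<bullet> x + c \<and> a \<bullet> x + c < of_int m + 1"
    by (auto simp: \<Q>_def int_S)
  ultimately show ?thesis by blast
qed

text \<open>The real and imaginary parts of \<open>M\<close> are inner products with
  \<open>adjoint M 1\<close> and \<open>adjoint M \<i>\<close>, both nonzero by surjectivity.
  Cutting into slabs for one and then the other gives the claim.\<close>

lemma subdivision_grid: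
  fixes M :: "'a::euclidean_space \<Rightarrow> complex"
  assumes P: "polytope P" "interior P \<noteq> {}" and M: "linear M" "surj M"
  shows "\<exists>\<Q>. subdivision \<Q> P \<and>
    (\<forall>Q\<in>\<Q>. \<exists>m n::int. \<forall>x\<in>interior Q.
       of_int m < Re (M x + c) \<and> Re (M x + c) < of_int m + 1 \<and>
       of_int n < Im (M x + c) \<and> Im (M x + c) < of_int n + 1)"
proof -
  have Re: "Re (M x) = adjoint M 1 \<bullet> x" and Im: "Im (M x) = adjoint M \<i> \<bullet> x" for x
    by (simp_all add: adjoint_clauses(2)[OF M(1)])
  have nz: "adjoint M 1 \<noteq> 0" "adjoint M \<i> \<noteq> 0"
  proof -
    obtain x y where "M x = 1" "M y = \<i>" using M(2) by (metis surjD)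
    then show "adjoint M 1 \<noteq> 0" "adjoint M \<i> \<noteq> 0" using Re[of x] Im[of y] by auto
  qed
  obtain \<Q> where Q: "subdivision \<Q> P"
    "\<forall>Q\<in>\<Q>. \<exists>m::int. \<forall>x\<in>interior Q. of_int m < Re (M x + c) \<and> Re (M x + c) < of_int m + 1"
    using subdivision_slabs[OF P nz(1), of "Re c"] by (auto simp: Re)
  show ?thesis
  proof (rule subdivision_refine[OF Q(1)])
    fix Q assume "Q \<in> \<Q>"
    then have poly: "polytope Q" "interior Q \<noteq> {}" using Q(1) by (auto simp: subdivision_def)
    obtain m :: int where m: "\<forall>x\<in>interior Q. of_int m < Re (M x + c) \<and> Re (M x + c) < of_int m + 1"
      using Q(2) \<open>Q \<in> \<Q>\<close> by blast
    obtain \<R> where R: "subdivision \<R> Q"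
      "\<forall>R\<in>\<R>. \<exists>n::int. \<forall>x\<in>interior R. of_int n < Im (M x + c) \<and> Im (M x + c) < of_int n + 1"
      using subdivision_slabs[OF poly nz(2), of "Im c"] by (auto simp: Im)
    have "interior R \<subseteq> interior Q" if "R \<in> \<R>" for R
      using R(1) that by (intro interior_mono) (auto simp: subdivision_def)
    then have "\<exists>m n::int. \<forall>x\<in>interior R.
       of_int m < Re (M x + c) \<and> Re (M x + c) < of_int m + 1 \<and>
       of_int n < Im (M x + c) \<and> Im (M x + c) < of_int n + 1" if "R \<in> \<R>" for R
      using m R(2) that by (meson subsetD)
    with R(1) show "\<exists>\<R>. subdivision \<R> Q \<and> (\<forall>R\<in>\<R>. \<exists>m n::int. \<forall>x\<in>interior R.
       of_int m < Re (M x + c) \<and> Re (M x + c) < of_int m + 1 \<and>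
       of_int n < Im (M x + c) \<and> Im (M x + c) < of_int n + 1)"
      by blast
  qed
qed

section \<open>The unit cube as a fundamental domain of the torus\<close>

definition unit_cube :: "(complex ^ 2) set" where
  "unit_cube = cbox 0 (\<chi> k. Complex 1 1)"

lemma mem_unit_cube: "x \<in> unit_cube \<longleftrightarrow> (\<forall>k. 0 \<le> Re (x $ k) \<and> Re (x $ k) \<le> 1 \<and> 0 \<le> Im (x $ k) \<and> Im (x $ k) \<le> 1)"
  by (auto simp: unit_cube_def mem_box Basis_vec_def inner_axis Basis_complex_def)

lemma mem_interior_unit_cube:
  "x \<in> interior unit_cube \<longleftrightarrow> (\<forall>k. 0 < Re (x $ k) \<and> Re (x $ k) < 1 \<and> 0 < Im (x $ k) \<and> Im (x $ k) < 1)"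
  by (auto simp: unit_cube_def interior_cbox mem_box Basis_vec_def inner_axis Basis_complex_def)

lemma subdivision_unit_cube: "subdivision {unit_cube} unit_cube"
proof -
  have "(\<chi> k. Complex (1/2) (1/2)) \<in> interior unit_cube"
    by (simp add: mem_interior_unit_cube)
  moreover have "polytope unit_cube" by (simp add: unit_cube_def polytope_interval)
  ultimately show ?thesis by (auto simp: subdivision_def)
qed

lemma inj_on_proj_interior_unit_cube: "inj_on proj (interior unit_cube)"
proof (rule inj_onI)
  fix x y assume xy: "x \<in> interior unit_cube" "y \<in> interior unit_cube" "proj x = proj y"
  have z: "t = u" if "t - u \<in> \<int>" "0 < t" "t < 1" "0 < u" "u < 1" for t u :: real
  proof -
    obtain k where "t - u = of_int k" using \<open>t - u \<in> \<int>\<close> by (auto elim: Ints_cases)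
    with that show ?thesis by (cases "k = 0") linarith+
  qed
  show "x = y"
    using xy z unfolding proj_eq_iff mem_interior_unit_cube
    by (auto simp: vec_eq_iff complex_eq_iff gauss_int_def)
qed

lemma proj_unit_cube: "proj ` unit_cube = UNIV"
proof -
  have "p \<in> proj ` unit_cube" for p
  proof -
    obtain x where p: "p = proj x" by (rule proj_surj)
    let ?y = "\<chi> k. Complex (frac (Re (x $ k))) (frac (Im (x $ k)))"
    have "proj x = proj ?y" by (simp add: proj_eq_iff gauss_int_def frac_def)
    moreover have "?y \<in> unit_cube"
      by (simp add: mem_unit_cube frac_lt_1 less_imp_le)
    ultimately show ?thesis using p by blast
  qed
  then show ?thesis by blast
qed

text \<open>All interiors lie in the open cube, where \<open>proj\<close> is injective, so
  disjointness survives the projection.\<close>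

lemma torus_partition_subdivision:
  assumes "subdivision \<P> unit_cube"
  shows "torus_partition \<P>"
proof -
  have sub: "interior P \<subseteq> interior unit_cube" if "P \<in> \<P>" for P
    using assms that by (intro interior_mono) (auto simp: subdivision_def)
  have "disjnt (proj ` interior P) (proj ` interior Q)" if "P \<in> \<P>" "Q \<in> \<P>" "P \<noteq> Q" for P Q
  proof -
    have "interior P \<inter> interior Q = {}"
      using assms that by (auto simp: subdivision_def pairwise_def disjnt_def)
    then show ?thesis
      using inj_on_image_Int[OF inj_on_proj_interior_unit_cube sub[OF that(1)] sub[OF that(2)]]
      by (metis disjnt_def image_empty)
  qed
  moreover have "(\<Union>P\<in>\<P>. proj ` P) = UNIV"
    using assms proj_unit_cube by (metis image_Union subdivision_def)
  ultimately show ?thesis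
    using assms inj_on_subset[OF inj_on_proj_interior_unit_cube sub]
    by (auto simp: torus_partition_def subdivision_def pairwise_def)
qed

text \<open>The difference of the two maps sends short vectors to lattice vectors of norm below 1,
  that is, to zero; scaling extends this to all vectors.\<close>

lemma linear_eq_if_proj_eq:
  fixes M N :: "complex ^ 2 \<Rightarrow> complex ^ 2"
  assumes "linear M" "linear N" "e > 0" and eq: "\<And>u. norm u < e \<Longrightarrow> proj (M u) = proj (N u)"
  shows "M = N"
proof
  fix v
  define K where "K = (\<lambda>u. M u - N u)"
  have K: "linear K" unfolding K_def using assms(1,2) by (rule linear_compose_sub)
  \<comment> \<open>Chosen so that \<open>t *\<^sub>R v\<close> is shorter than \<open>e\<close> and
    its image under \<open>K\<close> shorter than 1; the added 1 in the denominators covers zero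
    vectors.\<close>
  define t where "t = min (e / (2 * (norm v + 1))) (1 / (2 * (norm (K v) + 1)))"
  have t: "t > 0" using \<open>e > 0\<close> by (simp add: t_def add_nonneg_pos)
  have small: "t * a < b" if "t \<le> b / (2 * (a + 1))" "b > 0" "a \<ge> 0" for a b
  proof -
    have "t * a \<le> b / (2 * (a + 1)) * a" using that by (intro mult_right_mono)
    also have "\<dots> < b" using that by (simp add: field_simps add_nonneg_pos)
    finally show ?thesis .
  qed
  have "norm (t *\<^sub>R v) < e"
    using small[of e "norm v"] t \<open>e > 0\<close> by (simp add: t_def)
  then have g: "K (t *\<^sub>R v) $ k \<in> gauss_int" for k
    using eq by (simp add: proj_eq_iff K_def)
  have "norm (K (t *\<^sub>R v)) < 1"
    using small[of 1 "norm (K v)"] t by (simp add: t_def linear_scale[OF K])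
  then have "norm (K (t *\<^sub>R v) $ k) < 1" for k
    by (meson Finite_Cartesian_Product.norm_nth_le le_less_trans)
  then have "\<bar>Re (K (t *\<^sub>R v) $ k)\<bar> < 1" "\<bar>Im (K (t *\<^sub>R v) $ k)\<bar> < 1" for k
    by (meson abs_Re_le_cmod abs_Im_le_cmod le_less_trans)+
  then have "K (t *\<^sub>R v) $ k = 0" for k
    using g[of k] by (auto simp: gauss_int_def complex_eq_iff Ints_nonzero_abs_less1)
  then have "K (t *\<^sub>R v) = 0" by (simp add: vec_eq_iff)
  then show "M v = N v" using t by (simp add: linear_scale[OF K]) (simp add: K_def)
qed

text \<open>This gives independence of the point at every \<open>p\<close> having a linear part, not
  only at interior points of pieces.\<close>

lemma has_linear_part_subdivision:
  assumes sub: "subdivision \<P> unit_cube" and L: "linear L"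
    and f: "\<And>P. P \<in> \<P> \<Longrightarrow> \<exists>b. \<forall>x\<in>interior P. f (proj x) = Some (proj (L x + b))"
    and M: "has_linear_part f p M"
  shows "M = L"
proof -
  obtain x where "x \<in> unit_cube" and p: "p = proj x" using proj_unit_cube by (metis UNIV_I imageE)
  then obtain P where P: "P \<in> \<P>" "x \<in> P" using sub by (auto simp: subdivision_def)
  then have poly: "polytope P" "interior P \<noteq> {}" using sub by (auto simp: subdivision_def)
  obtain b where b: "\<And>x. x \<in> interior P \<Longrightarrow> f (proj x) = Some (proj (L x + b))" using f P by blast
  obtain q where "linear M" and q: "\<forall>\<^sub>F v in nhds 0. f (p + proj v) = Some (q + proj (M v))"
    using M by (auto simp: has_linear_part_def)
  then obtain e where e: "e > 0" "\<And>v. norm v < e \<Longrightarrow> f (p + proj v) = Some (q + proj (M v))"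
    by (auto simp: eventually_nhds_metric)
  \<comment> \<open>The lift \<open>x\<close> may lie on the boundary of \<open>P\<close>, so the
    two affine expressions are compared near a point \<open>y\<close> interior to \<open>P\<close>
    and close to \<open>x\<close>.\<close>
  have "closure (interior P) = P"
    using poly by (simp add: convex_closure_interior polytope_imp_convex polytope_imp_closed)
  then obtain y where y: "y \<in> interior P" "dist y x < e"
    using P(2) e(1) by (metis closure_approachable)
  obtain e' where e': "e' > 0" "ball y e' \<subseteq> interior P \<inter> ball x e"
    using y open_contains_ball[of "interior P \<inter> ball x e"]
    by (metis IntI dist_commute mem_ball open_Int open_ball open_interior)
  have *: "proj (L y + b) + proj (L u) = q + proj (M (y - x)) + proj (M u)" if "norm u < e'" for u
  proof -
    have "y + u \<in> ball y e'" using that by (simp add: dist_norm)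
    with e'(2) have "y + u \<in> interior P \<inter> ball x e" by blast
    then have yu: "y + u \<in> interior P" "norm (y + u - x) < e"
      by (simp_all add: dist_norm norm_minus_commute[of x])
    have "f (proj (y + u)) = Some (q + proj (M (y + u - x)))"
      using e(2)[OF yu(2)] by (simp add: p flip: proj_add)
    then have "proj (L (y + u) + b) = q + proj (M (y + u - x))"
      using b[OF yu(1)] by simp
    moreover have "L (y + u) + b = L y + b + L u" "M (y + u - x) = M (y - x) + M u"
      using L \<open>linear M\<close> by (simp_all add: linear_add linear_diff)
    ultimately show ?thesis by (simp add: proj_add add.assoc)
  qed
  have "proj (M u) = proj (L u)" if "norm u < e'" for u
  proof -
    have "proj 0 = 0" by (metis add_cancel_left_right proj_add)
    moreover have "L 0 = 0" "M 0 = 0" using L \<open>linear M\<close> by (simp_all add: linear_0)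
    ultimately have "proj (L y + b) = q + proj (M (y - x))" using *[of 0] e'(1) by simp
    then show ?thesis using *[OF that] by simp
  qed
  then show ?thesis using linear_eq_if_proj_eq[OF \<open>linear M\<close> L e'(1)] by blast
qed

section \<open>The piecewise affine action\<close>

text \<open>Each further letter refines the pieces until the coordinate it reads stays in one open
  unit square, where the turn is affine. Only the constant \<open>b\<close> depends on the
  piece.\<close>

lemma torus_act_subdivision:
  "\<exists>\<P>. subdivision \<P> unit_cube \<and>
    (\<forall>P\<in>\<P>. \<exists>b. \<forall>x\<in>interior P. torus_act s g (proj x) = proj (act_linear s g x + b))"
proof (induction g)
  case Nil
  have "\<forall>P\<in>{unit_cube}. \<exists>b. \<forall>x\<in>interior P. torus_act s [] (proj x) = proj (act_linear s [] x + b)"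
    by (auto intro: exI[of _ 0])
  then show ?case using subdivision_unit_cube by blast
next
  case (Cons a g)
  then obtain \<P> where sub: "subdivision \<P> unit_cube"
    and \<P>: "\<And>P. P \<in> \<P> \<Longrightarrow> \<exists>b. \<forall>x\<in>interior P. torus_act s g (proj x) = proj (act_linear s g x + b)"
    by blast
  show ?case
  proof (rule subdivision_refine[OF sub])
    fix P assume P: "P \<in> \<P>"
    then have poly: "polytope P" "interior P \<noteq> {}" using sub by (auto simp: subdivision_def)
    obtain b where b: "\<And>x. x \<in> interior P \<Longrightarrow> torus_act s g (proj x) = proj (act_linear s g x + b)"
      using \<P> P by blast
    define M where "M = (\<lambda>x. act_linear s g x $ coord a)"
    have "linear M"
      using linear_act_linear[of s g] by (auto intro!: linearI simp: M_def linear_add linear_scale)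
    moreover have "surj M"
      unfolding surj_def
    proof
      fix y :: complex
      obtain x where "(\<chi> k. y) = act_linear s g x"
        by (rule surjE[OF surj_act_linear])
      then have "M x = y" unfolding M_def by (metis vec_lambda_beta)
      then show "\<exists>x. y = M x" by blast
    qed
    ultimately obtain \<Q> where \<Q>: "subdivision \<Q> P"
      "\<And>Q. Q \<in> \<Q> \<Longrightarrow> \<exists>m n::int. \<forall>x\<in>interior Q.
       of_int m < Re (M x + b $ coord a) \<and> Re (M x + b $ coord a) < of_int m + 1 \<and>
       of_int n < Im (M x + b $ coord a) \<and> Im (M x + b $ coord a) < of_int n + 1"
      using subdivision_grid[OF poly, of M "b $ coord a"] by blast
    have "\<exists>c. \<forall>x\<in>interior Q. torus_act s (a # g) (proj x) = proj (act_linear s (a # g) x + c)"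
      if Q: "Q \<in> \<Q>" for Q
    proof -
      have QP: "interior Q \<subseteq> interior P"
        using \<Q>(1) Q by (intro interior_mono) (auto simp: subdivision_def)
      obtain m n :: int where mn: "\<And>x. x \<in> interior Q \<Longrightarrow>
         of_int m < Re (M x + b $ coord a) \<and> Re (M x + b $ coord a) < of_int m + 1 \<and>
         of_int n < Im (M x + b $ coord a) \<and> Im (M x + b $ coord a) < of_int n + 1"
        using \<Q>(2)[OF Q] by blast
      \<comment> \<open>The centre of the unit square containing the coordinate. It enters only the
        translation part of the composite.\<close>
      define h where "h = Complex (of_int m + 1/2) (of_int n + 1/2)"
      have "torus_act s (a # g) (proj x)
          = proj (act_linear s (a # g) x + (turn_linear s a b + ((1 + \<i>) * h) *s disp_dir s a))"
        if x: "x \<in> interior Q" for x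
      proof -
        have "torus_act s (a # g) (proj x) = torus_turn s a (proj (act_linear s g x + b))"
          using b x QP by auto
        also have "\<dots> = proj (act_linear s g x + b
            + (- (1 + \<i>) * (M x + b $ coord a - h)) *s disp_dir s a)"
          using turn_disp_eq[of m "M x + b $ coord a" n] mn[OF x]
          by (simp add: torus_turn_proj M_def h_def)
        also have "act_linear s g x + b + (- (1 + \<i>) * (M x + b $ coord a - h)) *s disp_dir s a
            = act_linear s (a # g) x + (turn_linear s a b + ((1 + \<i>) * h) *s disp_dir s a)"
          by (simp add: turn_linear_def M_def vec_eq_iff algebra_simps)
        finally show ?thesis .
      qed
      then show ?thesis by blast
    qed
    with \<Q>(1) show "\<exists>\<Q>. subdivision \<Q> P \<and> (\<forall>Q\<in>\<Q>. \<exists>c. \<forall>x\<in>interior Q.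
        torus_act s (a # g) (proj x) = proj (act_linear s (a # g) x + c))"
      by blast
  qed
qed

lemma piecewise_affine_torus_act: "piecewise_affine (Some \<circ> torus_act s g)"
proof -
  obtain \<P> where "subdivision \<P> unit_cube"
    "\<forall>P\<in>\<P>. \<exists>b. \<forall>x\<in>interior P. torus_act s g (proj x) = proj (act_linear s g x + b)"
    using torus_act_subdivision by blast
  then show ?thesis
    using linear_act_linear torus_partition_subdivision
    unfolding piecewise_affine_def by (intro exI[of _ \<P>]) fastforce
qed

lemma has_linear_part_torus_act:
  assumes "has_linear_part (Some \<circ> torus_act s g) p M"
  shows "M = act_linear s g"
proof -
  obtain \<P> where "subdivision \<P> unit_cube"
    "\<forall>P\<in>\<P>. \<exists>b. \<forall>x\<in>interior P. torus_act s g (proj x) = proj (act_linear s g x + b)"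
    using torus_act_subdivision by blast
  then show ?thesis
    using has_linear_part_subdivision[OF _ linear_act_linear _ assms] by simp
qed

text \<open>As \<open>torus_act s g\<close> is a bijection of the whole torus, its range has empty
  complement, which settles density and full measure at once.\<close>

lemma polytope_exchange_torus_act:
  assumes "act_linear s g = id"
  shows "polytope_exchange (Some \<circ> torus_act s g)"
proof -
  obtain \<P> where "subdivision \<P> unit_cube"
    "\<forall>P\<in>\<P>. \<exists>b. \<forall>x\<in>interior P. torus_act s g (proj x) = proj (act_linear s g x + b)"
    using torus_act_subdivision by blast
  then have "piecewise_translation (Some \<circ> torus_act s g)"
    using torus_partition_subdivision assms
    unfolding piecewise_translation_def by (intro exI[of _ \<P>]) fastforce
  moreover have "inj (torus_act s g)" "surj (torus_act s g)"
    using bij_torus_act[of s g] by (simp_all add: bij_def)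
  then have "inj_on (Some \<circ> torus_act s g) (dom (Some \<circ> torus_act s g))"
    "ran (Some \<circ> torus_act s g) = UNIV"
    by (auto simp: inj_on_def ran_def surj_def) metis
  ultimately show ?thesis
    by (simp add: polytope_exchange_def torus_null_def)
qed

theorem theorem1p6:
  fixes s :: real
  assumes "s > 0" and "s \<notin> \<rat>"
  shows "\<exists>(F :: gen list \<Rightarrow> torus4 \<rightharpoonup> torus4) (L :: gen list \<Rightarrow> complex ^ 2 \<Rightarrow> complex ^ 2).
    piecewise_affine_action F \<and>
    (\<forall>z. \<exists>\<tau>. is_translation \<tau> \<and>
       (\<forall>g\<in>carrier G4.
          agree (map_option (\<tau> \<circ> Psi s) \<circ> square_action s z g) (F g \<circ> (\<tau> \<circ> Psi s)))) \<and>
    (\<forall>g\<in>carrier G4. \<forall>p M. has_linear_part (F g) p M \<longrightarrow> M = L g) \<and>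
    (\<forall>g. stationary g \<longrightarrow> L g = id \<and> polytope_exchange (F g)) \<and>
    (\<forall>g. drifter g \<longrightarrow>
       nontrivial_complex_parabolic (L g) \<and>
       {v. L g v = v} = vec.span {vector [1, 1 / of_real s]})"
proof (intro exI[of _ "\<lambda>g. Some \<circ> torus_act s g"] exI[of _ "act_linear s"] conjI)
  have s: "s \<noteq> 0" using assms(1) by simp
  show "piecewise_affine_action (\<lambda>g. Some \<circ> torus_act s g)"
    by (auto simp: piecewise_affine_action_def agree_def piecewise_affine_torus_act torus_act_mult map_comp_def)
      (simp add: Z4_free_Z4_def)
  show "\<forall>z. \<exists>\<tau>. is_translation \<tau> \<and> (\<forall>g\<in>carrier G4.
      agree (map_option (\<tau> \<circ> Psi s) \<circ> square_action s z g) ((Some \<circ> torus_act s g) \<circ> (\<tau> \<circ> Psi s)))"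
  proof
    fix z
    \<comment> \<open>Subtracting \<open>z / s\<close> in the second coordinate moves the vertex
      \<open>z\<close> of the second grid to a lattice point and leaves the first grid
      alone.\<close>
    define \<tau> where "\<tau> = (\<lambda>p. p + proj (vector [0, - z / of_real s]))"
    have \<tau>: "\<tau> (Psi s w) = proj (vector [w, (w - z) / of_real s])" for w
      unfolding \<tau>_def Psi_def proj_add[symmetric]
      by (rule arg_cong[where f = proj]) (simp add: vec_eq_iff forall_2 diff_divide_distrib)
    have "agree (map_option (\<tau> \<circ> Psi s) \<circ> square_action s z g) ((Some \<circ> torus_act s g) \<circ> (\<tau> \<circ> Psi s))" for g
      using torus_act_Psi[OF assms(1)] by (auto simp: agree_def \<tau>)
    moreover have "is_translation \<tau>" by (auto simp: is_translation_def \<tau>_def)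
    ultimately show "\<exists>\<tau>. is_translation \<tau> \<and> (\<forall>g\<in>carrier G4.
      agree (map_option (\<tau> \<circ> Psi s) \<circ> square_action s z g) ((Some \<circ> torus_act s g) \<circ> (\<tau> \<circ> Psi s)))"
      by blast
  qed
  show "\<forall>g\<in>carrier G4. \<forall>p M. has_linear_part (Some \<circ> torus_act s g) p M \<longrightarrow> M = act_linear s g"
    using has_linear_part_torus_act by blast
  show "\<forall>g. stationary g \<longrightarrow> act_linear s g = id \<and> polytope_exchange (Some \<circ> torus_act s g)"
    using act_linear_stationary[OF s] polytope_exchange_torus_act by blast
  show "\<forall>g. drifter g \<longrightarrow> nontrivial_complex_parabolic (act_linear s g) \<and>
      {v. act_linear s g v = v} = vec.span {vector [1, 1 / of_real s]}"
    using act_linear_drifter[OF s] by blast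
qed

end
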